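(* Let $\mathfrak n_{3,1}$ be the Lie algebra over $\mathbb F$ with ordered basis $\{x_1,x_2,x_3\}$ whose only nonzero Lie bracket among the basis elements is $[x_3,x_2]=-x_1$ (up to skew-symmetry). Then for all $j,k,l,m,n,p\in\mathbb Z_{\ge0}$ the following identity holds in $\mathbf U(\mathfrak n_{3,1})$: $$\left(x_1^jx_2^kx_3^l\right)\left(x_1^mx_2^nx_3^p\right)=\sum_{\alpha=0}^{\min\{l,n\}}\binom{l}{\alpha}\binom{n}{\alpha}\alpha!(-1)^{\alpha}x_1^{j+m+\alpha}x_2^{k+n-\alpha}x_3^{l+p-\alpha}.$$
   Context: $\mathbb F$ is $\mathbb R$ or $\mathbb C$. $\mathbf U(L)$ denotes the universal enveloping algebra of the Lie algebra $L$ (the universal unital associative $\mathbb F$-algebra with a linear map $\iota:L\to\mathbf U(L)$ satisfying $\iota([x,y])=\iota(x)\iota(y)-\iota(y)\iota(x)$). Elements of $L$ are identified with their images under $\iota$, so $xy=yx+[x,y]$ in $\mathbf U(L)$ for $x,y\in L$; powers and products of the $x_i$ are taken in $\mathbf U(L)$. *)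

theory Defs
  imports Complex_Main "HOL-Library.Poly_Mapping" "HOL-Library.Product_Plus" "HOL-Algebra.QuotRing" "HOL-Algebra.Module"
begin

section \<open>The ground field\<close>

text \<open>
  The class consists of the fields that are isomorphic, as fields, to the reals or to the
  complex numbers; the types \<^typ>\<open>real\<close> and \<^typ>\<open>complex\<close> are instances.
\<close>

class real_or_complex = field +
  assumes real_or_complex:
    "(\<exists>f :: 'a \<Rightarrow> real. bij f \<and> f 1 = 1 \<and>
        (\<forall>x y. f (x + y) = f x + f y) \<and> (\<forall>x y. f (x * y) = f x * f y)) \<or>
     (\<exists>f :: 'a \<Rightarrow> complex. bij f \<and> f 1 = 1 \<and>
        (\<forall>x y. f (x + y) = f x + f y) \<and> (\<forall>x y. f (x * y) = f x * f y))"

instance real :: real_or_complex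
  by (intro_classes, rule disjI1, rule exI[of _ id]) simp

instance complex :: real_or_complex
  by (intro_classes, rule disjI2, rule exI[of _ id]) simp


section \<open>Lie algebras\<close>

locale lie_algebra = vector_space scale
  for scale :: "'f::field \<Rightarrow> 'a::ab_group_add \<Rightarrow> 'a" +
  fixes bracket :: "'a \<Rightarrow> 'a \<Rightarrow> 'a"
  assumes bracket_add_left: "bracket (x + y) z = bracket x z + bracket y z"
    and bracket_add_right: "bracket x (y + z) = bracket x y + bracket x z"
    and bracket_scale_left: "bracket (scale c x) y = scale c (bracket x y)"
    and bracket_scale_right: "bracket x (scale c y) = scale c (bracket x y)"
    and bracket_self: "bracket x x = 0"
    and jacobi: "bracket x (bracket y z) + bracket y (bracket z x) + bracket z (bracket x y) = 0"

locale lie_n31 = lie_algebra scale bracket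
  for scale :: "'f::field \<Rightarrow> 'a::ab_group_add \<Rightarrow> 'a" and bracket +
  fixes x1 x2 x3 :: 'a
  assumes distinct_basis: "distinct [x1, x2, x3]"
    and independent_basis: "\<not> dependent {x1, x2, x3}"
    and span_basis: "span {x1, x2, x3} = UNIV"
    and bracket_x3_x2: "bracket x3 x2 = - x1"
    and bracket_x1_x2: "bracket x1 x2 = 0"
    and bracket_x1_x3: "bracket x1 x3 = 0"


lemma lie_n31_exists:
  "lie_n31 (\<lambda>c (a1, a2, a3). (c * a1, c * a2, c * a3))
     (\<lambda>(a1, a2, a3) (b1, b2, b3). (a2 * b3 - a3 * b2, 0, 0 :: 'f::field))
     (1, 0, 0) (0, 1, 0) (0, 0, 1)"
proof -
  interpret vector_space "\<lambda>c (a1, a2, a3). (c * a1, c * a2, c * a3 :: 'f)"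
    by unfold_locales (auto simp: algebra_simps)
  have "b \<in> span {(1, 0, 0), (0, 1, 0), (0, 0, 1)}" for b
  proof -
    obtain b1 b2 b3 where b: "b = (b1, b2, b3)" by (cases b)
    have "b - (b1, 0, 0) - (0, b2, 0) - (0, 0, b3) \<in> span {}" by (simp add: b zero_prod_def)
    then show ?thesis
      unfolding span_breakdown_eq
      by (intro exI[of _ b1] exI[of _ b2] exI[of _ b3]) simp
  qed
  moreover have "\<not> dependent {(1, 0, 0), (0, 1, 0), (0, 0, 1)}"
    by (auto simp: independent_insert span_breakdown_eq zero_prod_def)
  ultimately show ?thesis
    by unfold_locales (auto simp: algebra_simps zero_prod_def)
qed


section \<open>Unital associative algebras\<close>

text \<open>
  The locale \<^locale>\<open>algebra\<close> of the library is restricted to commutative algebras, so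
  only the record type with its scalar multiplication is reused here.
\<close>

locale unital_algebra = ring A
  for A :: "('f::field, 'b) module" (structure) +
  assumes smult_closed [simp, intro]: "x \<in> carrier A \<Longrightarrow> c \<odot> x \<in> carrier A"
    and smult_l_distr: "x \<in> carrier A \<Longrightarrow> (c + d) \<odot> x = c \<odot> x \<oplus> d \<odot> x"
    and smult_r_distr: "x \<in> carrier A \<Longrightarrow> y \<in> carrier A \<Longrightarrow> c \<odot> (x \<oplus> y) = c \<odot> x \<oplus> c \<odot> y"
    and smult_assoc1: "x \<in> carrier A \<Longrightarrow> (c * d) \<odot> x = c \<odot> (d \<odot> x)"
    and smult_one [simp]: "x \<in> carrier A \<Longrightarrow> 1 \<odot> x = x"
    and smult_mult_left: "x \<in> carrier A \<Longrightarrow> y \<in> carrier A \<Longrightarrow> (c \<odot> x) \<otimes> y = c \<odot> (x \<otimes> y)"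
    and smult_mult_right: "x \<in> carrier A \<Longrightarrow> y \<in> carrier A \<Longrightarrow> x \<otimes> (c \<odot> y) = c \<odot> (x \<otimes> y)"

definition algebra_hom ::
    "('f::field, 'b) module \<Rightarrow> ('f, 'c) module \<Rightarrow> ('b \<Rightarrow> 'c) \<Rightarrow> bool" where
  "algebra_hom A B h \<longleftrightarrow>
     h \<in> ring_hom A B \<and> (\<forall>c. \<forall>x \<in> carrier A. h (c \<odot>\<^bsub>A\<^esub> x) = c \<odot>\<^bsub>B\<^esub> h x)"

definition lie_map ::
    "('f::field \<Rightarrow> 'a::ab_group_add \<Rightarrow> 'a) \<Rightarrow> ('a \<Rightarrow> 'a \<Rightarrow> 'a) \<Rightarrow> ('f, 'b) module \<Rightarrow> ('a \<Rightarrow> 'b) \<Rightarrow> bool"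
  where
  "lie_map scale bracket A f \<longleftrightarrow>
     range f \<subseteq> carrier A \<and>
     (\<forall>x y. f (x + y) = f x \<oplus>\<^bsub>A\<^esub> f y) \<and>
     (\<forall>c x. f (scale c x) = c \<odot>\<^bsub>A\<^esub> f x) \<and>
     (\<forall>x y. f (bracket x y) = f x \<otimes>\<^bsub>A\<^esub> f y \<ominus>\<^bsub>A\<^esub> f y \<otimes>\<^bsub>A\<^esub> f x)"


section \<open>The free unital associative algebra on a set\<close>

text \<open>Words under concatenation, written additively because \<^type>\<open>poly_mapping\<close>
  takes its product from an additive monoid of exponents.\<close>

datatype 'a word = Word (letters: "'a list")

instantiation word :: (type) monoid_add
begin

definition "0 = Word []"

definition "u + v = Word (letters u @ letters v)"

instance
  by intro_classes (simp_all add: zero_word_def plus_word_def)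

end

text \<open>Finitely supported functions on words, i.e. noncommutative polynomials with the
  elements of \<^typ>\<open>'a\<close> as variables.\<close>

definition free_alg :: "('f::field, 'a word \<Rightarrow>\<^sub>0 'f) module" where
  "free_alg = \<lparr>carrier = UNIV, mult = (*), one = 1, zero = 0, add = (+),
     smult = (\<lambda>c p. Poly_Mapping.single 0 c * p)\<rparr>"

definition gen :: "'a \<Rightarrow> 'a word \<Rightarrow>\<^sub>0 'f::field" where
  "gen x = Poly_Mapping.single (Word [x]) 1"


section \<open>The universal enveloping algebra\<close>

text \<open>
  A concrete model of the universal enveloping algebra, whose universal property is proved below:
  the quotient of the free algebra on the underlying set of the Lie algebra by the two-sided
  ideal that makes the canonical map linear and turns brackets into commutators.  The quotient
  by the linearity relations alone is the tensor algebra.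
\<close>

definition uea_relations ::
    "('f::field \<Rightarrow> 'a::ab_group_add \<Rightarrow> 'a) \<Rightarrow> ('a \<Rightarrow> 'a \<Rightarrow> 'a) \<Rightarrow> ('a word \<Rightarrow>\<^sub>0 'f) set" where
  "uea_relations scale bracket =
     {gen (x + y) - (gen x + gen y) | x y. True} \<union>
     {gen (scale c x) - c \<odot>\<^bsub>free_alg\<^esub> gen x | c x. True} \<union>
     {gen (bracket x y) - (gen x * gen y - gen y * gen x) | x y. True}"

definition uea_ideal ::
    "('f::field \<Rightarrow> 'a::ab_group_add \<Rightarrow> 'a) \<Rightarrow> ('a \<Rightarrow> 'a \<Rightarrow> 'a) \<Rightarrow> ('a word \<Rightarrow>\<^sub>0 'f) set" where
  "uea_ideal scale bracket = Idl\<^bsub>free_alg\<^esub> (uea_relations scale bracket)"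

definition uea ::
    "('f::field \<Rightarrow> 'a::ab_group_add \<Rightarrow> 'a) \<Rightarrow> ('a \<Rightarrow> 'a \<Rightarrow> 'a) \<Rightarrow> ('f, ('a word \<Rightarrow>\<^sub>0 'f) set) module" where
  "uea scale bracket =
     ring.extend (free_alg Quot uea_ideal scale bracket)
       (module.fields
         (\<lambda>c C. \<Union>p \<in> C. uea_ideal scale bracket +>\<^bsub>free_alg\<^esub> (c \<odot>\<^bsub>free_alg\<^esub> p)))"

definition uea_incl ::
    "('f::field \<Rightarrow> 'a::ab_group_add \<Rightarrow> 'a) \<Rightarrow> ('a \<Rightarrow> 'a \<Rightarrow> 'a) \<Rightarrow> 'a \<Rightarrow> ('a word \<Rightarrow>\<^sub>0 'f) set" where
  "uea_incl scale bracket x = uea_ideal scale bracket +>\<^bsub>free_alg\<^esub> gen x"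

subsection \<open>It has the universal property\<close>

lemma free_alg_simps [simp]:
  "carrier free_alg = UNIV" "mult free_alg = (*)" "one free_alg = 1"
  "zero free_alg = 0" "add free_alg = (+)"
  "smult free_alg = (\<lambda>c p. Poly_Mapping.single 0 c * p)"
  by (simp_all add: free_alg_def)

lemma update_eq_single_plus:
  assumes "a \<notin> Poly_Mapping.keys p"
  shows "Poly_Mapping.update a b p = Poly_Mapping.single a b + p"
  using assms
  by (intro poly_mapping_eqI) (auto simp: lookup_update lookup_add lookup_single in_keys_iff)

lemma single_zero_commute:
  fixes c :: "'f::field" and p :: "'a word \<Rightarrow>\<^sub>0 'f"
  shows "p * Poly_Mapping.single 0 c = Poly_Mapping.single 0 c * p"
proof (induction p rule: Poly_Mapping.update_induct)
  case (update f a b)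
  then show ?case
    by (simp add: update_eq_single_plus distrib_left distrib_right mult_single mult.commute)
qed simp

lemma unital_algebra_free_alg: "unital_algebra (free_alg :: ('f::field, 'a word \<Rightarrow>\<^sub>0 'f) module)"
proof (intro unital_algebra.intro unital_algebra_axioms.intro ringI abelian_groupI monoidI)
  show "\<exists>q \<in> carrier free_alg. q \<oplus>\<^bsub>free_alg\<^esub> p = \<zero>\<^bsub>free_alg\<^esub>" for p :: "'a word \<Rightarrow>\<^sub>0 'f"
    by (rule bexI[of _ "- p"]) simp_all
  show "(c * d) \<odot>\<^bsub>free_alg\<^esub> p = c \<odot>\<^bsub>free_alg\<^esub> (d \<odot>\<^bsub>free_alg\<^esub> p)"
    for c d :: 'f and p :: "'a word \<Rightarrow>\<^sub>0 'f"
    by (simp add: mult.assoc[symmetric] mult_single)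
  show "p \<otimes>\<^bsub>free_alg\<^esub> (c \<odot>\<^bsub>free_alg\<^esub> q) = c \<odot>\<^bsub>free_alg\<^esub> (p \<otimes>\<^bsub>free_alg\<^esub> q)"
    for c :: 'f and p q :: "'a word \<Rightarrow>\<^sub>0 'f"
    by (simp add: mult.assoc[symmetric] single_zero_commute)
qed (simp_all add: algebra_simps single_add)

interpretation free: unital_algebra "free_alg :: ('f::field, 'a word \<Rightarrow>\<^sub>0 'f) module"
  by (rule unital_algebra_free_alg)

lemma free_a_inv [simp]: "\<ominus>\<^bsub>free_alg\<^esub> p = - p"
  by (rule free.minus_equality) simp_all

lemma free_a_minus [simp]: "p \<ominus>\<^bsub>free_alg\<^esub> q = p - q"
  by (simp add: a_minus_def)

lemma ideal_uea_ideal: "ideal (uea_ideal scale bracket) free_alg"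
  unfolding uea_ideal_def by (rule free.genideal_ideal) simp

lemma uea_relations_subset: "uea_relations scale bracket \<subseteq> uea_ideal scale bracket"
  unfolding uea_ideal_def by (rule free.genideal_self) simp

lemma uea_simps:
  "carrier (uea scale bracket) = carrier (free_alg Quot uea_ideal scale bracket)"
  "mult (uea scale bracket) = mult (free_alg Quot uea_ideal scale bracket)"
  "one (uea scale bracket) = one (free_alg Quot uea_ideal scale bracket)"
  "zero (uea scale bracket) = zero (free_alg Quot uea_ideal scale bracket)"
  "add (uea scale bracket) = add (free_alg Quot uea_ideal scale bracket)"
  "smult (uea scale bracket) =
     (\<lambda>c C. \<Union>p \<in> C. uea_ideal scale bracket +>\<^bsub>free_alg\<^esub> (c \<odot>\<^bsub>free_alg\<^esub> p))"
  unfolding uea_def by (simp_all add: ring.defs module.defs)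

context
  fixes scale :: "'f::field \<Rightarrow> 'a::ab_group_add \<Rightarrow> 'a" and bracket :: "'a \<Rightarrow> 'a \<Rightarrow> 'a"
begin

interpretation I: ideal "uea_ideal scale bracket" free_alg
  by (rule ideal_uea_ideal)

abbreviation (input) cls :: "('a word \<Rightarrow>\<^sub>0 'f) \<Rightarrow> ('a word \<Rightarrow>\<^sub>0 'f) set" where
  "cls p \<equiv> uea_ideal scale bracket +>\<^bsub>free_alg\<^esub> p"

lemma carrier_uea: "carrier (uea scale bracket) = range cls"
  by (auto simp: uea_simps FactRing_def A_RCOSETS_def')

lemma mem_cls_iff: "p \<in> cls q \<longleftrightarrow> p - q \<in> uea_ideal scale bracket"
  by (auto simp: a_r_coset_def' intro: bexI[of _ "p - q"])

lemma cls_eq_iff: "cls p = cls q \<longleftrightarrow> p - q \<in> uea_ideal scale bracket"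
proof
  assume "cls p = cls q"
  then have "p \<in> cls q" using I.zero_closed by (metis mem_cls_iff diff_self free_alg_simps(4))
  then show "p - q \<in> uea_ideal scale bracket" by (simp add: mem_cls_iff)
next
  assume pq: "p - q \<in> uea_ideal scale bracket"
  have "x - p \<in> uea_ideal scale bracket \<longleftrightarrow> x - q \<in> uea_ideal scale bracket" for x
    using I.a_closed[of "x - p" "p - q"] I.a_closed[of "x - q" "- (p - q)"] I.a_inv_closed[OF pq] pq
    by auto
  then show "cls p = cls q" by (auto simp: mem_cls_iff)
qed

lemma uea_mult_cls: "cls p \<otimes>\<^bsub>uea scale bracket\<^esub> cls q = cls (p * q)"
  using I.rcoset_mult_add[of p q] by (simp add: uea_simps FactRing_def)

lemma uea_add_cls: "cls p \<oplus>\<^bsub>uea scale bracket\<^esub> cls q = cls (p + q)"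
  using I.a_rcos_sum[of p q] by (simp add: uea_simps FactRing_def)

lemma uea_one: "\<one>\<^bsub>uea scale bracket\<^esub> = cls 1"
  by (simp add: uea_simps FactRing_def)

lemma uea_zero: "\<zero>\<^bsub>uea scale bracket\<^esub> = cls 0"
  by (auto simp: uea_simps FactRing_def mem_cls_iff)

lemma uea_smult_cls: "c \<odot>\<^bsub>uea scale bracket\<^esub> cls p = cls (Poly_Mapping.single 0 c * p)"
proof -
  have "cls (Poly_Mapping.single 0 c * q) = cls (Poly_Mapping.single 0 c * p)" if "q \<in> cls p" for q
    using that I.I_l_closed[of "q - p" "Poly_Mapping.single 0 c"]
    by (simp add: mem_cls_iff cls_eq_iff right_diff_distrib)
  moreover have "p \<in> cls p" by (simp add: mem_cls_iff I.zero_closed[simplified])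
  ultimately show ?thesis unfolding uea_simps free_alg_simps by blast
qed

lemma ring_uea: "ring (uea scale bracket)"
proof -
  have *: "\<exists>y. cls y \<oplus>\<^bsub>uea scale bracket\<^esub> cls x = cls 0" for x
    by (rule exI[of _ "- x"]) (simp add: uea_add_cls)
  show ?thesis
    using *
    by (intro ringI abelian_groupI monoidI)
       (auto simp: carrier_uea uea_mult_cls uea_add_cls uea_one uea_zero algebra_simps)
qed

theorem unital_algebra_uea: "unital_algebra (uea scale bracket)"
proof (intro unital_algebra.intro ring_uea unital_algebra_axioms.intro)
  have *: "p * (Poly_Mapping.single 0 c * q) = Poly_Mapping.single 0 c * (p * q)"
    for c :: 'f and p q :: "'a word \<Rightarrow>\<^sub>0 'f"
    using free.smult_mult_right[of p q c] by simp
  fix x y assume "x \<in> carrier (uea scale bracket)" "y \<in> carrier (uea scale bracket)"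
  then obtain p q where "x = cls p" "y = cls q" by (auto simp: carrier_uea)
  then show "x \<otimes>\<^bsub>uea scale bracket\<^esub> (c \<odot>\<^bsub>uea scale bracket\<^esub> y) =
      c \<odot>\<^bsub>uea scale bracket\<^esub> (x \<otimes>\<^bsub>uea scale bracket\<^esub> y)" for c
    by (simp only: uea_mult_cls uea_smult_cls *)
next
  have "Poly_Mapping.single 0 (c * d) * p = Poly_Mapping.single 0 c * (Poly_Mapping.single 0 d * p)"
    for c d :: 'f and p :: "'a word \<Rightarrow>\<^sub>0 'f"
    using free.smult_assoc1[of p c d] by simp
  then show "(c * d) \<odot>\<^bsub>uea scale bracket\<^esub> x =
      c \<odot>\<^bsub>uea scale bracket\<^esub> (d \<odot>\<^bsub>uea scale bracket\<^esub> x)"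
    if "x \<in> carrier (uea scale bracket)" for c d x
    using that by (auto simp only: carrier_uea uea_smult_cls)
qed (auto simp: carrier_uea uea_mult_cls uea_add_cls uea_smult_cls distrib_left distrib_right
       single_add mult.assoc)

lemma uea_minus_cls: "cls p \<ominus>\<^bsub>uea scale bracket\<^esub> cls q = cls (p - q)"
proof -
  interpret U: ring "uea scale bracket" by (rule ring_uea)
  have "\<ominus>\<^bsub>uea scale bracket\<^esub> cls q = cls (- q)"
    by (rule U.minus_equality) (simp_all add: carrier_uea uea_add_cls uea_zero)
  then show ?thesis by (simp add: a_minus_def uea_add_cls)
qed

theorem lie_map_uea_incl: "lie_map scale bracket (uea scale bracket) (uea_incl scale bracket)"
proof -
  have "gen (x + y) - (gen x + gen y) \<in> uea_ideal scale bracket"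
    "gen (scale c x) - Poly_Mapping.single 0 c * gen x \<in> uea_ideal scale bracket"
    "gen (bracket x y) - (gen x * gen y - gen y * gen x) \<in> uea_ideal scale bracket" for x y c
    by (rule subsetD[OF uea_relations_subset], force simp: uea_relations_def)+
  then show ?thesis
    by (auto simp: lie_map_def uea_incl_def carrier_uea uea_mult_cls uea_add_cls uea_smult_cls
          uea_minus_cls cls_eq_iff)
qed

end

definition eval_word :: "('f::field, 'b) module \<Rightarrow> ('a \<Rightarrow> 'b) \<Rightarrow> 'a word \<Rightarrow> 'b" where
  "eval_word A f w = foldr (\<lambda>x a. f x \<otimes>\<^bsub>A\<^esub> a) (letters w) \<one>\<^bsub>A\<^esub>"

definition eval_free :: "('f::field, 'b) module \<Rightarrow> ('a \<Rightarrow> 'b) \<Rightarrow> ('a word \<Rightarrow>\<^sub>0 'f) \<Rightarrow> 'b" where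
  "eval_free A f p =
     (\<Oplus>\<^bsub>A\<^esub>w \<in> Poly_Mapping.keys p. Poly_Mapping.lookup p w \<odot>\<^bsub>A\<^esub> eval_word A f w)"

lemma (in unital_algebra) smult_zero_left: "x \<in> carrier A \<Longrightarrow> 0 \<odot> x = \<zero>"
  by (metis add.r_cancel_one' add_0 smult_closed smult_l_distr)

locale map_into_algebra = unital_algebra A
  for A :: "('f::field, 'b) module" (structure) and f :: "'c \<Rightarrow> 'b" +
  assumes f: "range f \<subseteq> carrier A"
begin

lemmas [simp] = smult_zero_left

lemma f_closed [simp]: "f x \<in> carrier A"
  using f by auto

lemma foldr_closed [simp]: "foldr (\<lambda>x a. f x \<otimes> a) xs \<one> \<in> carrier A"
  by (induction xs) auto

lemma eval_word_closed [simp]: "eval_word A f w \<in> carrier A"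
  by (simp add: eval_word_def)

lemma eval_word_add: "eval_word A f (u + v) = eval_word A f u \<otimes> eval_word A f v"
proof -
  have "foldr (\<lambda>x a. f x \<otimes> a) (xs @ ys) \<one> =
      foldr (\<lambda>x a. f x \<otimes> a) xs \<one> \<otimes> foldr (\<lambda>x a. f x \<otimes> a) ys \<one>" for xs ys
    proof (induction xs)
    case (Cons x xs)
    then show ?case unfolding append_Cons foldr_Cons o_apply by (simp add: m_assoc)
  qed simp
  then show ?thesis by (simp add: eval_word_def plus_word_def)
qed

lemma eval_free_superset:
  assumes "finite S" "Poly_Mapping.keys p \<subseteq> S"
  shows "eval_free A f p = (\<Oplus>w \<in> S. Poly_Mapping.lookup p w \<odot> eval_word A f w)"
  unfolding eval_free_def using assms
  by (intro add.finprod_mono_neutral_cong_left) (auto simp: in_keys_iff)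

lemma eval_free_closed [simp]: "eval_free A f p \<in> carrier A"
  unfolding eval_free_def by (intro finsum_closed) auto

lemma eval_free_add: "eval_free A f (p + q) = eval_free A f p \<oplus> eval_free A f q"
proof -
  define S where "S = Poly_Mapping.keys p \<union> Poly_Mapping.keys q"
  have S: "finite S" "Poly_Mapping.keys p \<subseteq> S" "Poly_Mapping.keys q \<subseteq> S"
    "Poly_Mapping.keys (p + q) \<subseteq> S"
    using Poly_Mapping.keys_add[of p q] by (auto simp: S_def)
  show ?thesis
    using S by (simp add: eval_free_superset[of S] lookup_add smult_l_distr finsum_addf Pi_def)
qed

lemma eval_free_single: "eval_free A f (Poly_Mapping.single w c) = c \<odot> eval_word A f w"
  by (subst eval_free_superset[of "{w}"]) auto

lemma eval_free_zero: "eval_free A f 0 = \<zero>"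
  by (simp add: eval_free_def)

lemma eval_free_mult: "eval_free A f (p * q) = eval_free A f p \<otimes> eval_free A f q"
proof (induction p rule: Poly_Mapping.update_induct)
  case const
  then show ?case by (simp add: eval_free_zero)
next
  case (update p u c)
  have "eval_free A f (Poly_Mapping.single u c * q) =
      eval_free A f (Poly_Mapping.single u c) \<otimes> eval_free A f q"
  proof (induction q rule: Poly_Mapping.update_induct)
    case const
    then show ?case by (simp add: eval_free_zero)
  next
    case (update q v d)
    then show ?case
      by (simp add: update_eq_single_plus distrib_left mult_single eval_free_add eval_free_single
          r_distr eval_word_add smult_mult_left smult_mult_right smult_assoc1[symmetric] mult.commute)
  qed
  with update show ?case
    by (simp add: update_eq_single_plus distrib_right eval_free_add l_distr)
qed

lemma eval_free_one: "eval_free A f 1 = \<one>"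
  unfolding single_one[symmetric] eval_free_single by (simp add: eval_word_def zero_word_def)

lemma eval_free_ring_hom: "ring_hom_ring free_alg A (eval_free A f)"
  by (rule ring_hom_ringI2)
     (auto intro!: ring_hom_memI free.ring_axioms ring_axioms
       simp: eval_free_mult eval_free_add eval_free_one)

lemma eval_free_gen: "eval_free A f (gen x) = f x"
  by (simp add: gen_def eval_free_single eval_word_def)

lemma eval_free_scalar: "eval_free A f (Poly_Mapping.single 0 c) = c \<odot> \<one>"
  by (simp add: eval_free_single eval_word_def zero_word_def)

end

theorem (in unital_algebra) uea_universal:
  fixes f :: "'a::ab_group_add \<Rightarrow> 'b"
  assumes f: "lie_map scale bracket A f"
  shows "\<exists>h. algebra_hom (uea scale bracket) A h \<and> (\<forall>x. h (uea_incl scale bracket x) = f x)"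
    and "\<lbrakk>algebra_hom (uea scale bracket) A h; \<forall>x. h (uea_incl scale bracket x) = f x;
          algebra_hom (uea scale bracket) A h'; \<forall>x. h' (uea_incl scale bracket x) = f x;
          C \<in> carrier (uea scale bracket)\<rbrakk> \<Longrightarrow> h C = h' C"
proof -
  let ?I = "uea_ideal scale bracket" and ?U = "uea scale bracket"
  let ?cls = "\<lambda>p. ?I +>\<^bsub>free_alg\<^esub> p"
  have rf: "range f \<subseteq> carrier A" using f by (simp add: lie_map_def)
  interpret F: map_into_algebra A f
    by unfold_locales (rule rf)
  interpret E: ring_hom_ring free_alg A "eval_free A f"
    by (rule F.eval_free_ring_hom)
  have diff: "eval_free A f (p - q) = eval_free A f p \<ominus> eval_free A f q" for p q
    using E.hom_add[of p "- q"] E.hom_a_inv[of q] by (simp add: a_minus_def)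
  note ev = F.eval_free_add F.eval_free_gen F.eval_free_mult
    F.eval_free_scalar smult_mult_left F.eval_free_closed F.f_closed diff
  have f_add: "f (x + y) = f x \<oplus> f y" and f_scale: "f (scale c x) = c \<odot> f x"
    and f_bracket: "f (bracket x y) = f x \<otimes> f y \<ominus> f y \<otimes> f x" for x y c
    using f by (simp_all add: lie_map_def)
  have self: "a \<ominus> a = \<zero>" if "a \<in> carrier A" for a
    using that by (simp add: r_neg minus_eq)
  have "eval_free A f r = \<zero>" if r: "r \<in> uea_relations scale bracket" for r
  proof -
    consider x y where "r = gen (x + y) - (gen x + gen y)"
      | c x where "r = gen (scale c x) - Poly_Mapping.single 0 c * gen x"
      | x y where "r = gen (bracket x y) - (gen x * gen y - gen y * gen x)"
      using r by (auto simp: uea_relations_def)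
    then show ?thesis
      by cases (simp_all add: ev f_add f_scale f_bracket self)
  qed
  then have "uea_relations scale bracket \<subseteq> a_kernel free_alg A (eval_free A f)"
    unfolding a_kernel_def' free_alg_simps(1) by blast
  then have "?I \<subseteq> a_kernel free_alg A (eval_free A f)"
    unfolding uea_ideal_def by (intro free.genideal_minimal E.kernel_is_ideal)
  then have ker: "eval_free A f p = \<zero>" if "p \<in> ?I" for p
    using that unfolding a_kernel_def' by blast
  have ev_eq: "eval_free A f p = eval_free A f q" if "?cls p = ?cls q" for p q
    using ker[of "p - q"] F.eval_free_add[of "p - q" q] that by (simp add: cls_eq_iff)
  define h where "h C = eval_free A f (SOME p. C = ?cls p)" for C
  have h: "h (?cls p) = eval_free A f p" for p
    unfolding h_def by (rule ev_eq[symmetric], rule someI) simp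
  have "algebra_hom ?U A h"
    unfolding algebra_hom_def ring_hom_def
    by (auto simp: carrier_uea uea_mult_cls uea_add_cls uea_one uea_smult_cls h ev F.eval_free_one)
  moreover have "\<forall>x. h (uea_incl scale bracket x) = f x"
    by (simp add: uea_incl_def h ev)
  ultimately show "\<exists>h. algebra_hom ?U A h \<and> (\<forall>x. h (uea_incl scale bracket x) = f x)"
    by blast
  show "h C = h' C"
    if hom: "algebra_hom ?U A h" "algebra_hom ?U A h'"
      and eq: "\<forall>x. h (uea_incl scale bracket x) = f x" "\<forall>x. h' (uea_incl scale bracket x) = f x"
      and C: "C \<in> carrier ?U" for h h' C
  proof -
    have unique: "g (?cls p) = eval_free A f p"
      if g: "algebra_hom ?U A g" "\<forall>x. g (uea_incl scale bracket x) = f x" for g p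
    proof -
      have add: "g (?cls (p + q)) = g (?cls p) \<oplus> g (?cls q)"
        and mult: "g (?cls (p * q)) = g (?cls p) \<otimes> g (?cls q)"
        and closed: "g (?cls p) \<in> carrier A"
        and one: "g (?cls 1) = \<one>" for p q
        using g(1)
        by (auto simp: algebra_hom_def ring_hom_def carrier_uea uea_one
            uea_mult_cls[symmetric] uea_add_cls[symmetric])
      have smult: "g (?cls (Poly_Mapping.single 0 c * p)) = c \<odot> g (?cls p)" for c p
        unfolding uea_smult_cls[symmetric] using g(1) by (simp add: algebra_hom_def carrier_uea)
      have gen: "g (?cls (gen x)) = f x" for x
        using g(2) by (simp add: uea_incl_def)
      have word: "g (?cls (Poly_Mapping.single (Word xs) 1)) = eval_word A f (Word xs)" for xs
      proof (induction xs)
        case Nil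
        have "Poly_Mapping.single (Word []) 1 = (1 :: 'a word \<Rightarrow>\<^sub>0 'f)"
          by (metis zero_word_def single_one)
        with one show ?case by (simp add: eval_word_def)
      next
        case (Cons x xs)
        have "Poly_Mapping.single (Word (x # xs)) 1 = gen x * Poly_Mapping.single (Word xs) (1::'f)"
          by (simp add: gen_def mult_single plus_word_def)
        with Cons show ?case by (simp add: mult gen eval_word_def)
      qed
      have single: "g (?cls (Poly_Mapping.single w c)) = c \<odot> eval_word A f w" for w c
        using smult[of c "Poly_Mapping.single w 1"] word[of "letters w"] by (simp add: mult_single)
      have zero: "g (?cls 0) = \<zero>"
        using single[of 0 0] by (simp add: F.eval_word_closed)
      show ?thesis
      proof (induction p rule: Poly_Mapping.update_induct)
        case const
        then show ?case by (simp add: zero F.eval_free_zero)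
      next
        case (update p w c)
        then show ?case
          by (simp add: update_eq_single_plus add single ev(1) F.eval_free_single)
      qed
    qed
    from C obtain p where "C = ?cls p" by (auto simp: carrier_uea)
    with unique[OF hom(1) eq(1)] unique[OF hom(2) eq(2)] show ?thesis by simp
  qed
qed

end

theory Submission
  imports Defs
begin

text \<open>
  Write \<open>x, y, z\<close> for the images of \<open>x1, x2, x3\<close> in the enveloping algebra.  There \<open>x\<close> commutes
  with \<open>y\<close> and \<open>z\<close>, and \<open>z y = y z - x\<close>; the identity follows from these three relations in any
  unital associative algebra.  Since \<open>x\<close> commutes with everything in sight, it suffices to reorder
  \<open>z^l y^n\<close>.

  Commutation with \<open>z\<close> acts on powers of \<open>y\<close> as the derivation \<open>- x d/dy\<close>, so that
  \<open>z y^n = y^n z - n x y^(n-1)\<close> (lemma \<open>mult_pow_commutator\<close>).  Moving the \<open>l\<close> factors \<open>z\<close> past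
  \<open>y^n\<close> one after the other produces a sum of monomials \<open>x^\<alpha> y^(n-\<alpha>) z^(l-\<alpha>)\<close>, where \<open>\<alpha>\<close>
  counts the factors \<open>z\<close> that were consumed in differentiating.  The coefficient of such a monomial
  chooses the \<open>\<alpha>\<close> consumed factors, carries a sign for each of them, and has the factor
  \<open>n (n-1) \<dots> (n-\<alpha>+1) = \<alpha>! (n choose \<alpha>)\<close> from the \<open>\<alpha>\<close>-fold derivative.  Formally this is an
  induction on \<open>l\<close> (lemma \<open>pow_mult_pow\<close>), in which Pascal's rule expresses the alternative between
  passing and being consumed (lemma \<open>reorder_coeff_Suc_Suc\<close>).
\<close>

text \<open>
  Up to the sign, this is the number of ways to match \<open>\<alpha>\<close> of \<open>l\<close> factors \<open>z\<close> injectively with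
  \<open>\<alpha>\<close> of \<open>n\<close> factors \<open>y\<close>, each matched pair being replaced by \<open>- x\<close>.
\<close>

definition reorder_coeff :: "nat \<Rightarrow> nat \<Rightarrow> nat \<Rightarrow> 'f::field" where
  "reorder_coeff l n \<alpha> =
     of_nat (l choose \<alpha>) * of_nat (n choose \<alpha>) * of_nat (fact \<alpha>) * (- 1) ^ \<alpha>"

lemma reorder_coeff_0 [simp]: "reorder_coeff l n 0 = 1"
  by (simp add: reorder_coeff_def)

lemma reorder_coeff_eq_0: "l < \<alpha> \<or> n < \<alpha> \<Longrightarrow> reorder_coeff l n \<alpha> = 0"
  by (auto simp: reorder_coeff_def binomial_eq_0)

text \<open>
  A new factor \<open>z\<close> either passes the remaining power of \<open>y\<close> (first summand) or is consumed by one
  of its \<open>n - \<alpha>\<close> factors (second summand).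
\<close>

lemma reorder_coeff_Suc_Suc:
  "(reorder_coeff (Suc l) n (Suc \<alpha>) :: 'f::field) =
     reorder_coeff l n (Suc \<alpha>) + reorder_coeff l n \<alpha> * (- of_nat (n - \<alpha>))"
proof -
  have "(n choose Suc \<alpha>) * Suc \<alpha> = (n choose \<alpha>) * (n - \<alpha>)"
    by (metis binomial_absorb_comp binomial_absorption mult.commute)
  then have "(n choose Suc \<alpha>) * fact (Suc \<alpha>) = (n choose \<alpha>) * (n - \<alpha>) * fact \<alpha>"
    by (simp add: mult.assoc[symmetric] del: mult_Suc mult_Suc_right)
  then have *: "of_nat (n choose Suc \<alpha>) * of_nat (fact (Suc \<alpha>)) =
      (of_nat (n choose \<alpha>) * of_nat (n - \<alpha>) * of_nat (fact \<alpha>) :: 'f)"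
    by (metis of_nat_mult)
  have "(reorder_coeff (Suc l) n (Suc \<alpha>) :: 'f) = reorder_coeff l n (Suc \<alpha>) -
      of_nat (l choose \<alpha>) * (of_nat (n choose Suc \<alpha>) * of_nat (fact (Suc \<alpha>))) * (- 1) ^ \<alpha>"
    by (simp add: reorder_coeff_def algebra_simps del: fact_Suc)
  also have "\<dots> = reorder_coeff l n (Suc \<alpha>) + reorder_coeff l n \<alpha> * (- of_nat (n - \<alpha>))"
    unfolding * by (simp add: reorder_coeff_def algebra_simps)
  finally show ?thesis .
qed

lemma (in monoid) commute_pow_pow:
  assumes "a \<in> carrier G" "b \<in> carrier G" "a \<otimes> b = b \<otimes> a"
  shows "b [^] (m::nat) \<otimes> a [^] (n::nat) = a [^] n \<otimes> b [^] m"
  using assms by (metis group_commutes_pow nat_pow_closed)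

text \<open>
  The first two relations make \<open>x\<close> commute with the other generators, and the third one is
  \<open>[z, y] = - x\<close>, solved for the product that is out of order.
\<close>

locale heisenberg_triple = unital_algebra A
  for A :: "('f::field, 'b) module" (structure) +
  fixes x y z :: 'b
  assumes x_closed [simp]: "x \<in> carrier A"
    and y_closed [simp]: "y \<in> carrier A"
    and z_closed [simp]: "z \<in> carrier A"
    and xy: "x \<otimes> y = y \<otimes> x"
    and xz: "x \<otimes> z = z \<otimes> x"
    and zy: "z \<otimes> y = y \<otimes> z \<oplus> (- 1) \<odot> x"
begin

abbreviation monomial :: "nat \<Rightarrow> nat \<Rightarrow> nat \<Rightarrow> 'b" where
  "monomial i j k \<equiv> x [^] i \<otimes> y [^] j \<otimes> z [^] k"

lemma pow_x_pow_y: "y [^] (j::nat) \<otimes> x [^] (i::nat) = x [^] i \<otimes> y [^] j"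
  by (simp add: commute_pow_pow xy)

lemma pow_x_pow_z: "z [^] (k::nat) \<otimes> x [^] (i::nat) = x [^] i \<otimes> z [^] k"
  by (simp add: commute_pow_pow xz)

text \<open>
  Each of the \<open>n\<close> factors \<open>y\<close> that \<open>z\<close> passes contributes one correction term \<open>- x y^(n-1)\<close>, and
  these terms are all equal because \<open>x\<close> commutes with \<open>y\<close>.  For \<open>n = 0\<close> the coefficient vanishes,
  so the truncated exponent \<open>n - 1\<close> does no harm.
\<close>

lemma mult_pow_commutator:
  "z \<otimes> y [^] n = y [^] n \<otimes> z \<oplus> (- of_nat n) \<odot> (x \<otimes> y [^] (n - 1))"
proof (induction n)
  case 0
  then show ?case by (simp add: smult_zero_left)
next
  case (Suc n)
  have pow: "(- of_nat n) \<odot> (x \<otimes> y [^] (n - 1) \<otimes> y) = (- of_nat n) \<odot> (x \<otimes> y [^] n)"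
    by (cases n) (simp_all add: smult_zero_left m_assoc)
  have "z \<otimes> y [^] Suc n = (z \<otimes> y [^] n) \<otimes> y"
    by (simp add: m_assoc)
  also have "\<dots> = y [^] n \<otimes> (z \<otimes> y) \<oplus> (- of_nat n) \<odot> (x \<otimes> y [^] (n - 1) \<otimes> y)"
    by (simp add: Suc.IH l_distr m_assoc smult_mult_left)
  also have "\<dots> = y [^] n \<otimes> y \<otimes> z \<oplus>
      ((- 1) \<odot> (x \<otimes> y [^] n) \<oplus> (- of_nat n) \<odot> (x \<otimes> y [^] n))"
    unfolding pow using pow_x_pow_y[of n 1]
    by (simp add: zy r_distr smult_mult_right m_assoc a_assoc)
  also have "\<dots> = y [^] Suc n \<otimes> z \<oplus> (- of_nat (Suc n)) \<odot> (x \<otimes> y [^] n)"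
    by (simp add: smult_l_distr[symmetric])
  finally show ?case by simp
qed

lemma mult_monomial:
  "z \<otimes> monomial i j k = monomial i j (Suc k) \<oplus> (- of_nat j) \<odot> monomial (Suc i) (j - 1) k"
proof -
  have "z \<otimes> monomial i j k = x [^] i \<otimes> (z \<otimes> y [^] j) \<otimes> z [^] k"
    using pow_x_pow_z[of 1 i] by (simp add: m_assoc[symmetric])
  also have "\<dots> = x [^] i \<otimes> (y [^] j \<otimes> z) \<otimes> z [^] k \<oplus>
      (- of_nat j) \<odot> (x [^] i \<otimes> (x \<otimes> y [^] (j - 1)) \<otimes> z [^] k)"
    by (simp add: mult_pow_commutator l_distr r_distr smult_mult_left smult_mult_right)
  also have "\<dots> = monomial i j (Suc k) \<oplus> (- of_nat j) \<odot> monomial (Suc i) (j - 1) k"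
    using nat_pow_comm[of z 1 k] by (simp add: m_assoc)
  finally show ?thesis .
qed

text \<open>
  The sum runs up to \<open>l\<close> rather than \<open>min l n\<close>, so that its range does not depend on which of the
  exponents is smaller; the coefficients vanish beyond \<open>n\<close>, where the exponent \<open>n - \<alpha>\<close> is
  truncated.
\<close>

lemma pow_mult_pow:
  "z [^] l \<otimes> y [^] n = (\<Oplus>\<alpha>\<in>{..l}. reorder_coeff l n \<alpha> \<odot> monomial \<alpha> (n - \<alpha>) (l - \<alpha>))"
proof (induction l)
  case 0
  then show ?case by simp
next
  case (Suc l)
  \<comment> \<open>Multiplication by \<open>z\<close> splits the term of index \<open>\<alpha>\<close> into \<open>passed \<alpha>\<close>, which keeps the power
     of \<open>x\<close>, and \<open>consumed \<alpha>\<close>, which raises it.  Collecting by the power of \<open>x\<close> therefore pairs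
     \<open>passed (Suc \<alpha>)\<close> with \<open>consumed \<alpha>\<close>.\<close>
  define passed where
    "passed \<alpha> = reorder_coeff l n \<alpha> \<odot> monomial \<alpha> (n - \<alpha>) (Suc l - \<alpha>)" for \<alpha>
  define consumed where
    "consumed \<alpha> = (reorder_coeff l n \<alpha> * (- of_nat (n - \<alpha>))) \<odot>
       monomial (Suc \<alpha>) (n - Suc \<alpha>) (l - \<alpha>)" for \<alpha>
  define target where
    "target \<alpha> = reorder_coeff (Suc l) n \<alpha> \<odot> monomial \<alpha> (n - \<alpha>) (Suc l - \<alpha>)" for \<alpha>
  have [simp]: "passed \<alpha> \<in> carrier A" "consumed \<alpha> \<in> carrier A" "target \<alpha> \<in> carrier A" for \<alpha>
    by (simp_all add: passed_def consumed_def target_def)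
  have step: "z \<otimes> (reorder_coeff l n \<alpha> \<odot> monomial \<alpha> (n - \<alpha>) (l - \<alpha>)) =
      passed \<alpha> \<oplus> consumed \<alpha>" if "\<alpha> \<le> l" for \<alpha>
    using that
    by (simp add: passed_def consumed_def smult_mult_right mult_monomial smult_r_distr
        smult_assoc1[symmetric] Suc_diff_le)
  have target_Suc: "target (Suc \<alpha>) = passed (Suc \<alpha>) \<oplus> consumed \<alpha>" for \<alpha>
    unfolding target_def passed_def consumed_def reorder_coeff_Suc_Suc
    by (subst smult_l_distr) simp_all
  have "target 0 = passed 0"
    by (simp add: target_def passed_def)
  have "passed (Suc l) = \<zero>"
    by (simp add: passed_def reorder_coeff_eq_0 smult_zero_left)

  have "z [^] Suc l \<otimes> y [^] n = z \<otimes> (z [^] l \<otimes> y [^] n)"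
    unfolding nat_pow_Suc2[OF z_closed] by (simp add: m_assoc)
  also have "\<dots> = (\<Oplus>\<alpha>\<in>{..l}. z \<otimes> (reorder_coeff l n \<alpha> \<odot> monomial \<alpha> (n - \<alpha>) (l - \<alpha>)))"
    unfolding Suc.IH by (rule finsum_rdistr) auto
  also have "\<dots> = (\<Oplus>\<alpha>\<in>{..l}. passed \<alpha> \<oplus> consumed \<alpha>)"
    by (rule finsum_cong') (auto simp: step)
  also have "\<dots> = (\<Oplus>\<alpha>\<in>{..Suc l}. passed \<alpha>) \<oplus> (\<Oplus>\<alpha>\<in>{..l}. consumed \<alpha>)"
    by (simp add: finsum_addf \<open>passed (Suc l) = \<zero>\<close>)
  also have "\<dots> = (\<Oplus>\<alpha>\<in>{..l}. target (Suc \<alpha>)) \<oplus> target 0"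
    by (simp add: finsum_Suc2 finsum_addf target_Suc \<open>target 0 = passed 0\<close> a_ac del: finsum_Suc)
  also have "\<dots> = (\<Oplus>\<alpha>\<in>{..Suc l}. target \<alpha>)"
    by (simp add: finsum_Suc2 del: finsum_Suc)
  finally show ?case by (simp only: target_def)
qed

theorem monomial_mult_monomial:
  "monomial j k l \<otimes> monomial m n p =
     (\<Oplus>\<alpha>\<in>{0..min l n}.
        reorder_coeff l n \<alpha> \<odot> monomial (j + m + \<alpha>) (k + n - \<alpha>) (l + p - \<alpha>))"
proof -
  \<comment> \<open>The outer factors \<open>y^k\<close> and \<open>z^p\<close> are already in order, so each reordered middle part only
     needs its power of \<open>x\<close> moved to the front.  As \<open>\<alpha> \<le> min l n\<close>, no subtraction is truncated.\<close>
  have monomial: "x [^] (j + m) \<otimes> y [^] k \<otimes> monomial \<alpha> (n - \<alpha>) (l - \<alpha>) \<otimes> z [^] p =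
      monomial (j + m + \<alpha>) (k + n - \<alpha>) (l + p - \<alpha>)" if "\<alpha> \<le> min l n" for \<alpha>
  proof -
    have "x [^] (j + m) \<otimes> y [^] k \<otimes> monomial \<alpha> (n - \<alpha>) (l - \<alpha>) \<otimes> z [^] p =
        x [^] (j + m) \<otimes> (y [^] k \<otimes> x [^] \<alpha>) \<otimes> y [^] (n - \<alpha>) \<otimes> (z [^] (l - \<alpha>) \<otimes> z [^] p)"
      by (simp add: m_assoc)
    also have "\<dots> = (x [^] (j + m) \<otimes> x [^] \<alpha>) \<otimes> (y [^] k \<otimes> y [^] (n - \<alpha>)) \<otimes>
        (z [^] (l - \<alpha>) \<otimes> z [^] p)"
      unfolding pow_x_pow_y by (simp add: m_assoc)
    also have "\<dots> = monomial (j + m + \<alpha>) (k + n - \<alpha>) (l + p - \<alpha>)"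
      using that by (simp add: nat_pow_mult)
    finally show ?thesis .
  qed
  have "monomial j k l \<otimes> monomial m n p =
      x [^] j \<otimes> y [^] k \<otimes> (z [^] l \<otimes> x [^] m) \<otimes> y [^] n \<otimes> z [^] p"
    by (simp add: m_assoc)
  also have "\<dots> = x [^] j \<otimes> (y [^] k \<otimes> x [^] m) \<otimes> (z [^] l \<otimes> y [^] n) \<otimes> z [^] p"
    unfolding pow_x_pow_z by (simp add: m_assoc)
  also have "\<dots> = x [^] (j + m) \<otimes> y [^] k \<otimes> (z [^] l \<otimes> y [^] n) \<otimes> z [^] p"
    unfolding pow_x_pow_y by (simp add: m_assoc nat_pow_mult[symmetric])
  also have "z [^] l \<otimes> y [^] n =
      (\<Oplus>\<alpha>\<in>{0..min l n}. reorder_coeff l n \<alpha> \<odot> monomial \<alpha> (n - \<alpha>) (l - \<alpha>))"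
    unfolding pow_mult_pow
    by (rule add.finprod_mono_neutral_cong_right) (auto simp: reorder_coeff_eq_0 smult_zero_left)
  also have "x [^] (j + m) \<otimes> y [^] k \<otimes> \<dots> \<otimes> z [^] p =
      (\<Oplus>\<alpha>\<in>{0..min l n}. x [^] (j + m) \<otimes> y [^] k \<otimes>
         (reorder_coeff l n \<alpha> \<odot> monomial \<alpha> (n - \<alpha>) (l - \<alpha>)) \<otimes> z [^] p)"
    by (simp add: finsum_ldistr finsum_rdistr Pi_def)
  also have "\<dots> = (\<Oplus>\<alpha>\<in>{0..min l n}.
      reorder_coeff l n \<alpha> \<odot> monomial (j + m + \<alpha>) (k + n - \<alpha>) (l + p - \<alpha>))"
    by (rule finsum_cong') (simp_all add: smult_mult_left smult_mult_right monomial)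
  finally show ?thesis .
qed

end

text \<open>
  The canonical map is linear and turns brackets into commutators, so the brackets of the basis
  become the three relations.
\<close>

lemma heisenberg_triple_uea:
  assumes "lie_n31 scale bracket x1 x2 x3"
  shows "heisenberg_triple (uea scale bracket)
    (uea_incl scale bracket x1) (uea_incl scale bracket x2) (uea_incl scale bracket x3)"
proof -
  interpret L: lie_n31 scale bracket x1 x2 x3 by (rule assms)
  interpret U: unital_algebra "uea scale bracket" by (rule unital_algebra_uea)
  let ?U = "uea scale bracket" and ?i = "uea_incl scale bracket"
  have closed: "?i u \<in> carrier ?U"
    and scale: "?i (scale c u) = c \<odot>\<^bsub>?U\<^esub> ?i u"
    and bracket: "?i (bracket u v) = ?i u \<otimes>\<^bsub>?U\<^esub> ?i v \<ominus>\<^bsub>?U\<^esub> ?i v \<otimes>\<^bsub>?U\<^esub> ?i u" for c u v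
    using lie_map_uea_incl[of scale bracket] by (auto simp: lie_map_def)
  have zero: "?i 0 = \<zero>\<^bsub>?U\<^esub>"
    using scale[of 0 0] by (simp add: U.smult_zero_left closed)
  have reorder: "?i u \<otimes>\<^bsub>?U\<^esub> ?i v = ?i v \<otimes>\<^bsub>?U\<^esub> ?i u \<oplus>\<^bsub>?U\<^esub> ?i (bracket u v)" for u v
    unfolding bracket using U.m_closed[OF closed closed]
    by (simp add: a_minus_def U.a_ac U.r_neg2 U.r_neg)
  have "?i (- x1) = (- 1) \<odot>\<^bsub>?U\<^esub> ?i x1"
    using scale[of "- 1" x1] by simp
  then show ?thesis
    using reorder[of x1 x2] reorder[of x1 x3] reorder[of x3 x2]
    by unfold_locales
       (simp_all add: closed zero L.bracket_x1_x2 L.bracket_x1_x3 L.bracket_x3_x2)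
qed

theorem theorem2p11:
  fixes scale :: "'f::real_or_complex \<Rightarrow> 'a::ab_group_add \<Rightarrow> 'a"
    and bracket :: "'a \<Rightarrow> 'a \<Rightarrow> 'a"
    and x1 x2 x3 :: 'a
    and j k l m n p :: nat
  assumes "lie_n31 scale bracket x1 x2 x3"
  shows "let U = uea scale bracket;
             X1 = uea_incl scale bracket x1;
             X2 = uea_incl scale bracket x2;
             X3 = uea_incl scale bracket x3
         in (X1 [^]\<^bsub>U\<^esub> j \<otimes>\<^bsub>U\<^esub> X2 [^]\<^bsub>U\<^esub> k \<otimes>\<^bsub>U\<^esub> X3 [^]\<^bsub>U\<^esub> l) \<otimes>\<^bsub>U\<^esub>
            (X1 [^]\<^bsub>U\<^esub> m \<otimes>\<^bsub>U\<^esub> X2 [^]\<^bsub>U\<^esub> n \<otimes>\<^bsub>U\<^esub> X3 [^]\<^bsub>U\<^esub> p) =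
            (\<Oplus>\<^bsub>U\<^esub>\<alpha> \<in> {0..min l n}.
               (of_nat (l choose \<alpha>) * of_nat (n choose \<alpha>) * of_nat (fact \<alpha>) * (- 1) ^ \<alpha>) \<odot>\<^bsub>U\<^esub>
               (X1 [^]\<^bsub>U\<^esub> (j + m + \<alpha>) \<otimes>\<^bsub>U\<^esub> X2 [^]\<^bsub>U\<^esub> (k + n - \<alpha>) \<otimes>\<^bsub>U\<^esub> X3 [^]\<^bsub>U\<^esub> (l + p - \<alpha>)))"
  using heisenberg_triple.monomial_mult_monomial[OF heisenberg_triple_uea[OF assms]]
  by (simp add: Let_def reorder_coeff_def)

end
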